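(* For $n\ge 1$ let \[ PB_n(t)=\sum_{k=1}^n \frac{2}{n(n+1)^2}\binom{n+1}{k-1}\binom{n+1}{k}\binom{n+1}{k+1}\,t^{k-1} \] (the Baxter polynomials). Then $\{PB_n(t)\}_{n\ge 1}$ is a Sturm sequence, i.e. every $PB_n(t)$ has only real zeros and $PB_1(t)\prec PB_2(t)\prec PB_3(t)\prec\cdots$.
   Context: For real polynomials $f,g$ with only real zeros, let $u_1\ge u_2\ge\cdots$ be the zeros of $f$ and $v_1\ge v_2\ge\cdots$ the zeros of $g$, each listed with multiplicity in weakly decreasing order. We say $g$ strictly interlaces $f$ if $\deg f=\deg g+1=n$ and $u_n< v_{n-1}< u_{n-1}<\cdots< v_1< u_1$ (for $n=1$ this condition is vacuous, so a nonzero constant strictly interlaces any polynomial of degree one). We say $g$ strictly alternates left of $f$ if $\deg f=\deg g=n$ and $v_n< u_n< v_{n-1}< u_{n-1}<\cdots< v_1< u_1$. We write $g\prec f$ if $g$ strictly interlaces $f$ or $g$ strictly alternates left of $f$. A sequence of real-rooted polynomials $\{f_n\}$ is a Sturm sequence if $f_n\prec f_{n+1}$ for all consecutive indices. *)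

theory Defs
  imports Complex_Main "HOL-Computational_Algebra.Computational_Algebra"
begin

definition real_rooted :: "real poly \<Rightarrow> bool" where
  "real_rooted p \<longleftrightarrow>
     p \<noteq> 0 \<and> (\<forall>z :: complex. poly (map_poly complex_of_real p) z = 0 \<longrightarrow> z \<in> \<real>)"

text \<open>
  The real zeros of a nonzero polynomial with multiplicity, in weakly decreasing order.
  For a real-rooted polynomial the list has length \<^term>\<open>degree p\<close>. Lists are indexed
  from 0, so \<^term>\<open>zeros p ! i\<close> is the zero with index \<open>i + 1\<close> in the usual
  notation \<open>u\<^sub>1 \<ge> u\<^sub>2 \<ge> \<dots>\<close>.
\<close>
definition zeros :: "real poly \<Rightarrow> real list" where
  "zeros p = rev (sorted_list_of_multiset (proots p))"

definition strictly_interlaces :: "real poly \<Rightarrow> real poly \<Rightarrow> bool" where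
  "strictly_interlaces g f \<longleftrightarrow>
     real_rooted g \<and> real_rooted f \<and> degree f = degree g + 1 \<and>
     (\<forall>i < degree g. zeros f ! (i + 1) < zeros g ! i \<and> zeros g ! i < zeros f ! i)"

definition strictly_alternates_left :: "real poly \<Rightarrow> real poly \<Rightarrow> bool" where
  "strictly_alternates_left g f \<longleftrightarrow>
     real_rooted g \<and> real_rooted f \<and> degree f = degree g \<and>
     (\<forall>i < degree f. zeros g ! i < zeros f ! i) \<and>
     (\<forall>i. i + 1 < degree f \<longrightarrow> zeros f ! (i + 1) < zeros g ! i)"

definition sturm_prec :: "real poly \<Rightarrow> real poly \<Rightarrow> bool" (infix "\<prec>" 50) where
  "g \<prec> f \<longleftrightarrow> strictly_interlaces g f \<or> strictly_alternates_left g f"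

text \<open>Here \<open>I\<close> is the index set of the sequence; values of \<open>f\<close> outside \<open>I\<close> are ignored.\<close>
definition sturm_sequence :: "nat set \<Rightarrow> (nat \<Rightarrow> real poly) \<Rightarrow> bool" where
  "sturm_sequence I f \<longleftrightarrow>
     (\<forall>n \<in> I. real_rooted (f n)) \<and> (\<forall>n. n \<in> I \<and> Suc n \<in> I \<longrightarrow> f n \<prec> f (Suc n))"

definition PB :: "nat \<Rightarrow> real poly" where
  "PB n = (\<Sum>k = 1..n. monom
     (2 / (real n * (real n + 1) ^ 2) *
        real ((n + 1) choose (k - 1)) * real ((n + 1) choose k) * real ((n + 1) choose (k + 1)))
     (k - 1))"

end

theory Submission imports Defs begin

text \<open>
  Up to a positive factor, the coefficient of \<open>t\<^sup>j\<close> in \<open>PB\<^sub>N\<^sub>+\<^sub>1\<close> is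
  \<open>1 / (j! (j+1)! (j+2)! (N-j)! (N-j+1)! (N-j+2)!)\<close>. The sequences \<open>j \<mapsto> 1 / (a+j)!\<close> are multiplier
  sequences: \<open>p \<mapsto> k p + t p'\<close> with \<open>k > 0\<close> preserves real-rootedness, and Euler's product
  for the Gamma function expresses \<open>1 / (a+j)!\<close> through the factors \<open>k + j\<close>. Multiplying \<open>(1+t)\<^sup>N\<close> by two such sequences and
  reversing shows that the polynomials \<open>A\<^sub>N\<close> with coefficients \<open>1 / (j! (N-j)! (N-j+1)! (N-j+2)!)\<close>
  are real-rooted, and they satisfy \<open>A\<^sub>N' = A\<^sub>N\<^sub>-\<^sub>1\<close>. Hence all combinations
  \<open>\<alpha> A\<^sub>N + \<beta> A\<^sub>N\<^sub>-\<^sub>1\<close> are real-rooted. Multiplication by \<open>1 / ((j+1)! (j+2)!)\<close> turns them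
  into arbitrary combinations of \<open>PB\<^sub>N\<^sub>+\<^sub>1\<close> and \<open>PB\<^sub>N\<close>, whose nonzero zeros are moreover
  simple. So the Wronskian of \<open>PB\<^sub>N\<^sub>+\<^sub>1\<close> and \<open>PB\<^sub>N\<close> does not vanish on the negative axis, and Rolle's
  theorem applied to \<open>PB\<^sub>N\<^sub>+\<^sub>1 / PB\<^sub>N\<close> gives strict interlacing.
\<close>

section \<open>Real-rooted polynomials\<close>

abbreviation cpoly :: "real poly \<Rightarrow> complex \<Rightarrow> complex" where
  "cpoly p \<equiv> poly (map_poly complex_of_real p)"

lemma cpoly_pCons [simp]: "cpoly (pCons a p) z = of_real a + z * cpoly p z"
  by (simp add: map_poly_pCons)

lemma cpoly_add [simp]: "cpoly (p + q) z = cpoly p z + cpoly q z"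
  by (induction p q rule: poly_induct2) (simp_all add: algebra_simps)

lemma cpoly_smult [simp]: "cpoly (smult c p) z = of_real c * cpoly p z"
  by (induction p) (simp_all add: algebra_simps)

lemma cpoly_mult [simp]: "cpoly (p * q) z = cpoly p z * cpoly q z"
  by (induction p) (simp_all add: algebra_simps)

lemma cpoly_of_real: "cpoly p (of_real x) = of_real (poly p x)"
  by (induction p) simp_all

lemma cpoly_cnj: "cpoly p (cnj z) = cnj (cpoly p z)"
  by (induction p) simp_all

lemma cpoly_eq_sum: "cpoly p z = (\<Sum>i\<le>degree p. of_real (coeff p i) * z ^ i)"
  by (simp add: poly_altdef degree_map_poly coeff_map_poly)

lemma real_rooted_const [simp]: "real_rooted [:c:] \<longleftrightarrow> c \<noteq> 0"
  by (auto simp: real_rooted_def)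

text \<open>Nonreal zeros of a real polynomial come in conjugate pairs, so the upper half-plane
  suffices.\<close>

lemma real_rooted_iff:
  "real_rooted p \<longleftrightarrow> p \<noteq> 0 \<and> (\<forall>z. Im z > 0 \<longrightarrow> cpoly p z \<noteq> 0)"
proof -
  have "Im z = 0" if *: "\<forall>z. Im z > 0 \<longrightarrow> cpoly p z \<noteq> 0" and z: "cpoly p z = 0" for z
  proof -
    have "cpoly p (cnj z) = 0" using z by (simp add: cpoly_cnj)
    then have "\<not> Im (cnj z) > 0" "\<not> Im z > 0" using * z by blast+
    then show ?thesis by simp
  qed
  then show ?thesis
    unfolding real_rooted_def complex_is_Real_iff by (metis less_irrefl)
qed

lemma real_rooted_mult_iff: "real_rooted (p * q) \<longleftrightarrow> real_rooted p \<and> real_rooted q"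
  by (auto simp: real_rooted_def)

lemma real_rooted_linear: "real_rooted [:a, b:] \<longleftrightarrow> a \<noteq> 0 \<or> b \<noteq> 0"
proof -
  have "cpoly [:a, b:] z \<noteq> 0" if "a \<noteq> 0 \<or> b \<noteq> 0" "Im z > 0" for z
    using that by (simp add: complex_eq_iff) auto
  then show ?thesis unfolding real_rooted_iff by (metis pCons_eq_0_iff)
qed

lemma real_rooted_induct [consumes 1, case_names const factor]:
  assumes "real_rooted p"
    and "\<And>c. c \<noteq> 0 \<Longrightarrow> P [:c:]"
    and "\<And>r q. real_rooted q \<Longrightarrow> P q \<Longrightarrow> P ([:-r, 1:] * q)"
  shows "P p"
  using assms(1)
proof (induction "degree p" arbitrary: p)
  case 0
  then obtain c where "p = [:c:]" by (metis degree_eq_zeroE)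
  then show ?case using 0 assms(2) by simp
next
  case (Suc d)
  have "\<not> constant (cpoly p)"
    using Suc(2) by (simp add: constant_degree degree_map_poly)
  then obtain z where z: "cpoly p z = 0"
    using fundamental_theorem_of_algebra by blast
  then have "z \<in> \<real>" using Suc(3) by (auto simp: real_rooted_def)
  then obtain r where "z = of_real r" by (auto elim: Reals_cases)
  then have "poly p r = 0" using z by (simp add: cpoly_of_real)
  then obtain q where q: "p = [:-r, 1:] * q" by (auto simp: poly_eq_0_iff_dvd)
  have "real_rooted q" using Suc(3) by (simp only: q real_rooted_mult_iff)
  moreover have "degree q = d"
  proof -
    have "q \<noteq> 0" using \<open>real_rooted q\<close> by (simp add: real_rooted_def)
    then have "degree p = Suc (degree q)" unfolding q by (subst degree_mult_eq) auto
    then show ?thesis using Suc(2) by simp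
  qed
  ultimately show ?case unfolding q using Suc(1) assms(3) by blast
qed

lemma size_proots_real_rooted: "real_rooted p \<Longrightarrow> size (proots p) = degree p"
proof (induction p rule: real_rooted_induct)
  case (factor r q)
  then have "q \<noteq> 0" by (simp add: real_rooted_def)
  then have "proots ([:-r, 1:] * q) = proots [:-r, 1:] + proots q"
     "degree ([:-r, 1:] * q) = degree [:-r, 1:] + degree q"
    by (intro proots_mult degree_mult_eq; simp)+
  then show ?case using factor by (simp del: mult_pCons_left)
qed simp

lemma real_rooted_reflect_poly: "real_rooted p \<Longrightarrow> real_rooted (reflect_poly p)"
proof (induction p rule: real_rooted_induct)
  case (factor r q)
  have "real_rooted (reflect_poly [:-r, 1:])"
  \<comment> \<open>Reversal sends the factor \<open>[:0, 1:]\<close> to the constant 1, so the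
    degree drops here.\<close>
  proof (cases "r = 0")
    case True
    then show ?thesis by (simp add: reflect_poly_pCons')
  qed (simp add: reflect_poly_pCons real_rooted_linear)
  then show ?case using factor by (simp add: reflect_poly_mult real_rooted_mult_iff del: mult_pCons_left)
qed simp

section \<open>The logarithmic derivative in the upper half-plane\<close>

text \<open>p'/p is the sum of 1/(z - r) over the zeros r, and each term has negative imaginary part
  when Im z > 0. Multiplying by |p|^2 clears the denominator.\<close>

lemma Im_pderiv_mult_cnj:
  assumes "real_rooted p" "Im z > 0"
  shows "Im (cpoly (pderiv p) z * cnj (cpoly p z)) \<le> 0"
    and "degree p > 0 \<Longrightarrow> Im (cpoly (pderiv p) z * cnj (cpoly p z)) < 0"
proof -
  have "Im (cpoly (pderiv p) z * cnj (cpoly p z)) \<le> 0 \<and>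
        (degree p > 0 \<longrightarrow> Im (cpoly (pderiv p) z * cnj (cpoly p z)) < 0)"
    using assms(1)
  proof (induction p rule: real_rooted_induct)
    case (factor r q)
    define a b where "a = cpoly q z" and "b = cpoly (pderiv q) z"
    have ab: "a \<noteq> 0" using factor(1) assms(2) by (simp add: a_def real_rooted_iff)
    have *: "cpoly (pderiv ([:-r, 1:] * q)) z * cnj (cpoly ([:-r, 1:] * q) z)
          = of_real ((cmod a)\<^sup>2) * cnj (z - of_real r) + of_real ((cmod (z - of_real r))\<^sup>2) * (b * cnj a)"
    proof -
      define w where "w = z - of_real r"
      have "cpoly ([:-r, 1:] * q) z = w * a"
        by (simp add: a_def w_def del: mult_pCons_left)
      moreover have "cpoly (pderiv ([:-r, 1:] * q)) z = a + w * b"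
        by (simp add: pderiv_mult pderiv_pCons a_def b_def w_def del: mult_pCons_left)
      ultimately show ?thesis
        unfolding w_def [symmetric] complex_norm_square by (simp add: algebra_simps)
    qed
    have "Im (b * cnj a) \<le> 0" using factor by (simp add: a_def b_def)
    then have "(cmod (z - of_real r))\<^sup>2 * Im (b * cnj a) \<le> 0"
      by (intro mult_nonneg_nonpos) auto
    moreover have "(cmod a)\<^sup>2 * Im z > 0" using ab assms(2) by simp
    ultimately show ?case
      unfolding * by simp
  qed simp
  then show "Im (cpoly (pderiv p) z * cnj (cpoly p z)) \<le> 0"
    and "degree p > 0 \<Longrightarrow> Im (cpoly (pderiv p) z * cnj (cpoly p z)) < 0" by auto
qed

text \<open>For b nonzero, a zero in the upper half-plane would make p'/p = -a/b real there.\<close>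

lemma real_rooted_lincomb_pderiv:
  assumes "real_rooted p" "a \<noteq> 0 \<or> b \<noteq> 0 \<and> degree p > 0"
  shows "real_rooted (smult a p + smult b (pderiv p))"
proof (cases "b = 0 \<or> degree p = 0")
  case True
  then have "smult a p + smult b (pderiv p) = [:a:] * p" "a \<noteq> 0"
    using assms(2) by (auto simp: pderiv_eq_0_iff)
  then show ?thesis using assms(1) by (simp only: real_rooted_mult_iff) simp
next
  case False
  have "cpoly (smult a p + smult b (pderiv p)) z \<noteq> 0" if "Im z > 0" for z
  proof
    assume "cpoly (smult a p + smult b (pderiv p)) z = 0"
    then have *: "of_real b * cpoly (pderiv p) z = - of_real a * cpoly p z"
      by (simp add: add_eq_0_iff)
    have "of_real b * (cpoly (pderiv p) z * cnj (cpoly p z)) = of_real (- a * (cmod (cpoly p z))\<^sup>2)"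
      unfolding mult.assoc [symmetric] * of_real_mult complex_norm_square by simp
    then have "b * Im (cpoly (pderiv p) z * cnj (cpoly p z)) = 0"
      unfolding complex_eq_iff by simp
    then show False using Im_pderiv_mult_cnj(2)[OF assms(1) that] False by simp
  qed
  moreover have "smult a p + smult b (pderiv p) \<noteq> 0"
    using calculation[of \<i>] by (auto simp del: cpoly_add cpoly_smult)
  ultimately show ?thesis by (simp add: real_rooted_iff del: cpoly_add cpoly_smult)
qed

text \<open>A zero z with Im z > 0 would give p'/p = -k/z, whose imaginary part is positive.\<close>

lemma real_rooted_euler:
  assumes "real_rooted p" "k > 0"
  shows "real_rooted (smult k p + pCons 0 (pderiv p))"
proof -
  have "cpoly (smult k p + pCons 0 (pderiv p)) z \<noteq> 0" if z: "Im z > 0" for z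
  proof
    assume "cpoly (smult k p + pCons 0 (pderiv p)) z = 0"
    then have *: "z * cpoly (pderiv p) z = - of_real k * cpoly p z"
      by (simp add: add_eq_0_iff)
    have "of_real ((cmod z)\<^sup>2) * (cpoly (pderiv p) z * cnj (cpoly p z))
       = cnj z * (z * cpoly (pderiv p) z) * cnj (cpoly p z)"
      unfolding complex_norm_square by (simp only: ac_simps)
    also have "\<dots> = of_real (- k * (cmod (cpoly p z))\<^sup>2) * cnj z"
      unfolding * of_real_mult complex_norm_square by (simp add: ac_simps)
    finally have "(cmod z)\<^sup>2 * Im (cpoly (pderiv p) z * cnj (cpoly p z)) = k * (cmod (cpoly p z))\<^sup>2 * Im z"
      unfolding complex_eq_iff by simp
    moreover have "k * (cmod (cpoly p z))\<^sup>2 * Im z > 0"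
      using assms z by (simp add: real_rooted_iff)
    moreover have "(cmod z)\<^sup>2 * Im (cpoly (pderiv p) z * cnj (cpoly p z)) \<le> 0"
      using Im_pderiv_mult_cnj(1)[OF assms(1) z] by (intro mult_nonneg_nonpos) auto
    ultimately show False by linarith
  qed
  moreover have "smult k p + pCons 0 (pderiv p) \<noteq> 0"
    using calculation[of \<i>] by (auto simp del: cpoly_add cpoly_smult cpoly_pCons)
  ultimately show ?thesis by (simp add: real_rooted_iff del: cpoly_add cpoly_smult cpoly_pCons)
qed

text \<open>Away from the zeros this says that -(p'/p)' is a sum of squares 1/(x - r)^2. The
  induction avoids division.\<close>

lemma laguerre_inequality:
  assumes "real_rooted p"
  shows "poly p x * poly (pderiv (pderiv p)) x \<le> (poly (pderiv p) x)\<^sup>2"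
  using assms
proof (induction p rule: real_rooted_induct)
  case (factor r q)
  have "poly (pderiv ([:-r, 1:] * q)) x ^ 2 - poly ([:-r, 1:] * q) x * poly (pderiv (pderiv ([:-r, 1:] * q))) x
     = poly q x ^ 2 + (x - r)\<^sup>2 * (poly (pderiv q) x ^ 2 - poly q x * poly (pderiv (pderiv q)) x)"
    by (simp add: pderiv_mult pderiv_add pderiv_pCons pderiv_diff pderiv_minus pderiv_smult del: mult_pCons_left)
       (simp add: algebra_simps power2_eq_square)
  also have "\<dots> \<ge> 0" using factor by simp
  finally show ?case by simp
qed simp

text \<open>Each factor satisfies |z - r| \<ge> |Im z|. The bound does not depend on the location of
  the zeros, so it survives limits.\<close>

lemma cmod_cpoly_ge:
  assumes "real_rooted p"
  shows "cmod (cpoly p z) \<ge> \<bar>lead_coeff p\<bar> * \<bar>Im z\<bar> ^ degree p"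
  using assms
proof (induction p rule: real_rooted_induct)
  case (factor r q)
  have "q \<noteq> 0" using factor by (simp add: real_rooted_def)
  then have d: "degree ([:-r, 1:] * q) = Suc (degree q)" by (subst degree_mult_eq) auto
  have l: "lead_coeff ([:-r, 1:] * q) = lead_coeff q"
    by (simp add: lead_coeff_mult del: mult_pCons_left)
  have "\<bar>lead_coeff ([:-r, 1:] * q)\<bar> * \<bar>Im z\<bar> ^ degree ([:-r, 1:] * q)
     = \<bar>Im z\<bar> * (\<bar>lead_coeff q\<bar> * \<bar>Im z\<bar> ^ degree q)"
    unfolding l by (simp add: d del: mult_pCons_left)
  also have "\<dots> \<le> cmod (z - of_real r) * cmod (cpoly q z)"
    using factor abs_Im_le_cmod[of "z - of_real r"] by (intro mult_mono) auto
  also have "\<dots> = cmod (cpoly ([:-r, 1:] * q) z)"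
    by (simp add: norm_mult del: mult_pCons_left)
  finally show ?case .
qed simp

text \<open>The lower bound \<open>cmod_cpoly_ge\<close> passes to the limit and takes the place of
  Hurwitz's theorem; the constant degree keeps it positive.\<close>

lemma real_rooted_limit:
  assumes rr: "\<And>n. real_rooted (f n)" and deg: "\<And>n. degree (f n) = degree p"
    and lim: "\<And>j. (\<lambda>n. coeff (f n) j) \<longlonglongrightarrow> coeff p j" and "p \<noteq> 0"
  shows "real_rooted p"
proof -
  have "cpoly p z \<noteq> 0" if z: "Im z > 0" for z
  proof -
    have "(\<lambda>n. cmod (cpoly (f n) z)) \<longlonglongrightarrow> cmod (cpoly p z)"
      unfolding cpoly_eq_sum deg by (intro tendsto_intros lim)
    moreover have "(\<lambda>n. \<bar>lead_coeff (f n)\<bar> * \<bar>Im z\<bar> ^ degree (f n)) \<longlonglongrightarrow> \<bar>lead_coeff p\<bar> * \<bar>Im z\<bar> ^ degree p"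
      unfolding deg by (intro tendsto_intros lim)
    ultimately have "cmod (cpoly p z) \<ge> \<bar>lead_coeff p\<bar> * \<bar>Im z\<bar> ^ degree p"
      using cmod_cpoly_ge[OF rr] by (intro LIMSEQ_le) auto
    moreover have "\<bar>lead_coeff p\<bar> * \<bar>Im z\<bar> ^ degree p > 0" using z assms by simp
    ultimately show ?thesis by auto
  qed
  then show ?thesis using assms by (simp add: real_rooted_iff)
qed

section \<open>Multiplier sequences\<close>

definition scale_coeffs :: "(nat \<Rightarrow> real) \<Rightarrow> real poly \<Rightarrow> real poly" where
  "scale_coeffs c p = (\<Sum>j\<le>degree p. monom (c j * coeff p j) j)"

lemma coeff_scale_coeffs [simp]: "coeff (scale_coeffs c p) j = c j * coeff p j"
  by (cases "j \<le> degree p") (auto simp: scale_coeffs_def coeff_sum coeff_eq_0)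

lemma scale_coeffs_scale_coeffs: "scale_coeffs c (scale_coeffs d p) = scale_coeffs (\<lambda>j. c j * d j) p"
  by (simp add: poly_eq_iff mult.assoc)

text \<open>Polya-Schur multiplier sequences with positive entries, so that scaling preserves the
  degree, as \<open>real_rooted_limit\<close> demands.\<close>

definition multiplier_sequence :: "(nat \<Rightarrow> real) \<Rightarrow> bool" where
  "multiplier_sequence c \<longleftrightarrow>
     (\<forall>j. c j > 0) \<and> (\<forall>p. real_rooted p \<longrightarrow> real_rooted (scale_coeffs c p))"

lemma degree_scale_coeffs:
  assumes "\<And>j. c j > 0"
  shows "degree (scale_coeffs c p) = degree p"
proof -
  have "c j \<noteq> 0" for j using assms[of j] by simp
  then show ?thesis unfolding degree_def by simp
qed

lemma multiplier_sequence_mult: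
  assumes "multiplier_sequence c" "multiplier_sequence d"
  shows "multiplier_sequence (\<lambda>j. c j * d j)"
  using assms unfolding multiplier_sequence_def scale_coeffs_scale_coeffs [symmetric] by simp

lemma multiplier_sequence_prod:
  assumes "\<And>k. k \<in> A \<Longrightarrow> multiplier_sequence (c k)"
  shows "multiplier_sequence (\<lambda>j. \<Prod>k\<in>A. c k j)"
  using assms
proof (induction A rule: infinite_finite_induct)
  case (insert k A)
  then show ?case by (simp add: multiplier_sequence_mult)
qed (simp_all add: multiplier_sequence_def scale_coeffs_def poly_as_sum_of_monoms)

text \<open>Scaling by these entries is the substitution of s t for t, up to the factor a.\<close>

lemma multiplier_sequence_power:
  assumes "a > 0" "s > 0"
  shows "multiplier_sequence (\<lambda>j. a * s ^ j)"
proof -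
  have "real_rooted (scale_coeffs (\<lambda>j. a * s ^ j) p)" if "real_rooted p" for p
  proof -
    have d: "degree (scale_coeffs (\<lambda>j. a * s ^ j) p) = degree p"
      using assms by (simp add: degree_scale_coeffs)
    have "cpoly (scale_coeffs (\<lambda>j. a * s ^ j) p) z = of_real a * cpoly p (of_real s * z)" for z
      unfolding cpoly_eq_sum d by (simp add: sum_distrib_left power_mult_distrib ac_simps)
    moreover have "scale_coeffs (\<lambda>j. a * s ^ j) p \<noteq> 0"
      using that assms by (auto simp: real_rooted_def poly_eq_iff)
    ultimately show ?thesis
      using that assms by (simp add: real_rooted_iff)
  qed
  then show ?thesis using assms by (simp add: multiplier_sequence_def)
qed

lemma scale_coeffs_linear:
  "scale_coeffs (\<lambda>j. k + real j) p = smult k p + pCons 0 (pderiv p)"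
  by (simp add: poly_eq_iff coeff_pCons coeff_pderiv ring_distribs split: nat.split)

lemma multiplier_sequence_linear:
  "k > 0 \<Longrightarrow> multiplier_sequence (\<lambda>j. k + real j)"
  using real_rooted_euler by (auto simp: multiplier_sequence_def scale_coeffs_linear intro: add_pos_nonneg)

lemma multiplier_sequence_limit:
  assumes "\<And>n. multiplier_sequence (c n)" "\<And>j. (\<lambda>n. c n j) \<longlonglongrightarrow> d j" "\<And>j. d j > 0"
  shows "multiplier_sequence d"
proof -
  have "real_rooted (scale_coeffs d p)" if "real_rooted p" for p
  proof (rule real_rooted_limit)
    show "real_rooted (scale_coeffs (c n) p)" for n
      using assms(1) that by (simp add: multiplier_sequence_def)
    show "degree (scale_coeffs (c n) p) = degree (scale_coeffs d p)" for n
      using assms(1,3) by (simp add: degree_scale_coeffs multiplier_sequence_def)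
    show "(\<lambda>n. coeff (scale_coeffs (c n) p) j) \<longlonglongrightarrow> coeff (scale_coeffs d p) j" for j
      by (auto intro: tendsto_intros assms(2))
    show "scale_coeffs d p \<noteq> 0"
      using that assms(3) by (auto simp: real_rooted_def poly_eq_iff less_le)
  qed
  then show ?thesis using assms(3) by (simp add: multiplier_sequence_def)
qed

section \<open>Reciprocal factorials as a multiplier sequence\<close>

lemma prod_Suc_add_eq_fact: "(\<Prod>k<m. real (a + Suc k)) = fact (a + m) / fact a"
proof (induction m)
  case (Suc m)
  show ?case unfolding prod.lessThan_Suc Suc.IH by simp
qed simp

lemma multiplier_sequence_inverse_fact: "multiplier_sequence (\<lambda>j. 1 / fact (a + j))"
proof (rule multiplier_sequence_limit)
  \<comment> \<open>finite stages of Euler's product for the Gamma function\<close>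
  define c where "c M j = (1 / fact (a + Suc M) * (1 / real (Suc M)) ^ j) *
     (\<Prod>k<Suc M. real (a + Suc k) + real j)" for M j
  show "multiplier_sequence (c M)" for M
    unfolding c_def
    by (intro multiplier_sequence_mult multiplier_sequence_power multiplier_sequence_prod
        multiplier_sequence_linear) simp_all
  have prod: "(\<Prod>k<m. real (a + Suc k) + real j) = fact (a + j + m) / fact (a + j)" for m j
    using prod_Suc_add_eq_fact[of "a + j" m] by (simp add: ac_simps)
  \<comment> \<open>The product telescopes to a quotient of factorials, so consecutive entries have
    a ratio tending to 1/(a+j+1). The limit then follows by induction on j.\<close>
  have step: "c M (Suc j) = c M j * ((1 + real (a + j + 1) / real (Suc M)) / real (Suc (a + j)))" for M j
    unfolding c_def prod by (simp add: field_simps del: of_nat_Suc) (simp add: field_simps)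
  show "(\<lambda>M. c M j) \<longlonglongrightarrow> 1 / fact (a + j)" for j
  proof (induction j)
    case 0
    have "c M 0 = 1 / fact a" for M
      unfolding c_def prod by simp
    then show ?case by simp
  next
    case (Suc j)
    have "(\<lambda>M. c M j * ((1 + real (a + j + 1) / real (Suc M)) / real (Suc (a + j))))
       \<longlonglongrightarrow> 1 / fact (a + j) * ((1 + 0) / real (Suc (a + j)))"
      by (intro tendsto_intros Suc LIMSEQ_Suc[OF lim_const_over_n]) simp
    moreover have "1 / fact (a + j) * ((1 + 0) / real (Suc (a + j))) = (1 / fact (a + Suc j) :: real)"
      by simp
    ultimately show ?case by (simp only: step)
  qed
qed simp

section \<open>Multiplicities of nonzero zeros\<close>

text \<open>At a nonzero zero of p the term t p' makes the order fall by exactly one. Where p does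
  not vanish, a double zero of k p + t p' would violate Laguerre's inequality.\<close>

lemma order_scale_coeffs_linear:
  assumes p: "real_rooted p" and k: "k > 0" and x: "x \<noteq> 0"
  shows "order x (scale_coeffs (\<lambda>j. k + real j) p) \<le> max 1 (order x p - 1)"
proof -
  define q where "q = scale_coeffs (\<lambda>j. k + real j) p"
  have "real_rooted q"
    using multiplier_sequence_linear[OF k] p by (simp add: q_def multiplier_sequence_def)
  then have q0: "q \<noteq> 0" and p0: "p \<noteq> 0" using p by (auto simp: real_rooted_def)
  have q: "q = smult k p + pCons 0 (pderiv p)" by (simp add: q_def scale_coeffs_linear)
  have "order x q \<le> max 1 (order x p - 1)"
  proof (cases "poly p x = 0")
    case True
    then obtain m where m: "order x p = Suc m" using p0 by (metis order_root not0_implies_Suc)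
    obtain h where h: "p = [:-x, 1:] ^ Suc m * h" "\<not> [:-x, 1:] dvd h"
      using order_decomp[OF p0, of x] m by auto
    have hx: "poly h x \<noteq> 0" using h(2) by (simp add: poly_eq_0_iff_dvd)
    define L G where "L = [:-x, 1:]" and "G = smult (of_nat (Suc m)) h + L * pderiv h"
    define g where "g = L * smult k h + pCons 0 G"
    have "pderiv L = 1" by (simp add: L_def pderiv_pCons)
    have "pderiv p = L ^ m * G"
      unfolding h(1) L_def [symmetric] pderiv_mult pderiv_power_Suc G_def \<open>pderiv L = 1\<close>
      by (simp only: mult_1_left mult_1_right power_Suc2 mult_smult_right mult_smult_left ac_simps distrib_left)
    moreover have "p = L ^ m * (L * h)" using h(1) by (simp only: L_def power_Suc2 mult.assoc)
    ultimately have "q = L ^ m * g"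
      by (simp only: q g_def mult_smult_right distrib_left mult_pCons_right smult_0_left add_0_left)
    \<comment> \<open>Terms containing \<open>L\<close> vanish at x, which leaves x (m+1)
      h(x).\<close>
    moreover have "poly g x \<noteq> 0"
      using hx x by (simp add: g_def L_def G_def del: of_nat_Suc)
    ultimately have "order x q = m"
      using q0 by (simp add: L_def order_mult order_power_n_n order_0I del: mult_pCons_left mult_pCons_right)
    then show ?thesis using m by simp
  next
    case False
    define p0 p1 p2 where "p0 = poly p x" and "p1 = poly (pderiv p) x" and "p2 = poly (pderiv (pderiv p)) x"
    have "order x q \<le> 1"
    proof (rule ccontr)
      assume "\<not> order x q \<le> 1"
      then have o: "order x q \<ge> 2" by simp
      have "poly q x = 0" using o by (auto simp: order_root)
      moreover have "poly (pderiv q) x = 0"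
        using order_pderiv[OF q0 \<open>poly q x = 0\<close>] o by (simp add: order_root)
      ultimately have 1: "x * p1 = - k * p0" and 2: "x * p2 = - (k + 1) * p1"
        by (simp_all add: q pderiv_add pderiv_smult pderiv_pCons p0_def p1_def p2_def algebra_simps add_eq_0_iff)
      \<comment> \<open>Eliminating p' and p'' through 1 and 2 gives k p^2 > 0, against Laguerre's
        inequality.\<close>
      have "x\<^sup>2 * (p0 * p2 - p1\<^sup>2) = p0 * (x * (x * p2)) - (x * p1)\<^sup>2"
        by (simp add: algebra_simps power2_eq_square)
      also have "\<dots> = - (k + 1) * p0 * (x * p1) - (x * p1)\<^sup>2"
        unfolding 2 by (simp add: algebra_simps)
      also have "\<dots> = k * p0\<^sup>2"
        unfolding 1 by (simp add: algebra_simps power2_eq_square)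
      finally have "x\<^sup>2 * (p0 * p2 - p1\<^sup>2) = k * p0\<^sup>2" .
      moreover have "x\<^sup>2 * (p0 * p2 - p1\<^sup>2) \<le> 0"
        using laguerre_inequality[OF p, of x]
        by (intro mult_nonneg_nonpos) (simp_all add: p0_def p1_def p2_def)
      ultimately show False using k False by (simp add: p0_def mult_le_0_iff)
    qed
    then show ?thesis by simp
  qed
  then show ?thesis by (simp add: q_def)
qed

text \<open>Since \<open>1 / (a+j)! = (a+1+j) / (a+1+j)!\<close>, the factor \<open>a + 1 + j\<close> can be split off repeatedly,
  each time lowering the multiplicities of multiple zeros.\<close>
lemma order_scale_coeffs_inverse_fact:
  assumes p: "real_rooted p" and x: "x \<noteq> 0"
  shows "order x (scale_coeffs (\<lambda>j. 1 / fact (a + j)) p) \<le> 1"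
proof -
  \<comment> \<open>\<open>K\<close> counts the factors split off; each lowers the trivial bound
    \<open>degree p\<close> by one, down to 1.\<close>
  have "order x (scale_coeffs (\<lambda>j. 1 / fact (a + j)) p) \<le> max 1 (degree p - K)" for K
  proof (induction K arbitrary: a)
    case 0
    have "scale_coeffs (\<lambda>j. 1 / fact (a + j)) p \<noteq> 0"
      using p by (auto simp: real_rooted_def poly_eq_iff)
    from order_degree[OF this, of x] show ?case by (simp add: degree_scale_coeffs)
  next
    case (Suc K)
    have "(1::real) / fact (a + j) = (real (Suc a) + real j) * (1 / fact (Suc a + j))" for j
      by (simp add: divide_simps add_nonneg_eq_0_iff)
    then have eq: "scale_coeffs (\<lambda>j. 1 / fact (a + j)) p
        = scale_coeffs (\<lambda>j. real (Suc a) + real j) (scale_coeffs (\<lambda>j. 1 / fact (Suc a + j)) p)"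
      unfolding scale_coeffs_scale_coeffs by presburger
    have "real_rooted (scale_coeffs (\<lambda>j. 1 / fact (Suc a + j)) p)"
      using p multiplier_sequence_inverse_fact[of "Suc a"] by (simp add: multiplier_sequence_def)
    then have "order x (scale_coeffs (\<lambda>j. real (Suc a) + real j) (scale_coeffs (\<lambda>j. 1 / fact (Suc a + j)) p))
        \<le> max 1 (order x (scale_coeffs (\<lambda>j. 1 / fact (Suc a + j)) p) - 1)"
      using x by (intro order_scale_coeffs_linear) simp_all
    then show ?case
      unfolding eq using Suc[of "Suc a"] by linarith
  qed
  from this[of "degree p"] show ?thesis by simp
qed

section \<open>Interlacing\<close>

lemma zeros_simple:
  assumes rr: "real_rooted p" and simple: "\<And>x. poly p x = 0 \<Longrightarrow> order x p = 1"
  shows "length (zeros p) = degree p" "set (zeros p) = {x. poly p x = 0}"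
    "sorted_wrt (>) (zeros p)"
proof -
  have p0: "p \<noteq> 0" using rr by (simp add: real_rooted_def)
  have mset: "mset (zeros p) = proots p" by (simp add: zeros_def)
  show "length (zeros p) = degree p"
    using size_proots_real_rooted[OF rr] unfolding mset [symmetric] by simp
  show s: "set (zeros p) = {x. poly p x = 0}"
    using p0 by (simp add: zeros_def)
  have "distinct (zeros p)"
  proof -
    have "count (mset (zeros p)) x = of_bool (x \<in> set (zeros p))" for x
      unfolding mset s using p0 simple[of x]
      by (cases "poly p x = 0") (simp_all add: order_0I)
    then show ?thesis unfolding distinct_count_atmost_1 of_bool_def by blast
  qed
  then have "sorted_wrt (<) (sorted_list_of_multiset (proots p))"
    unfolding zeros_def distinct_rev strict_sorted_iff by blast
  then show "sorted_wrt (>) (zeros p)"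
    unfolding zeros_def sorted_wrt_rev .
qed

text \<open>Without a zero of g between two consecutive zeros of f, Rolle's theorem for f/g would
  give a zero of the Wronskian. The gaps thus supply \<open>degree g\<close> distinct zeros of g,
  which must be all of them.\<close>

lemma strictly_interlacesI:
  assumes f: "real_rooted f" and g: "real_rooted g" and deg: "degree f = degree g + 1"
    and neg: "\<And>x. poly f x = 0 \<Longrightarrow> x < 0"
    and W: "\<And>x. x < 0 \<Longrightarrow> poly (pderiv f * g - f * pderiv g) x \<noteq> 0"
  shows "strictly_interlaces g f"
proof -
  have f0: "f \<noteq> 0" and g0: "g \<noteq> 0" using f g by (auto simp: real_rooted_def)
  \<comment> \<open>At a zero of f the Wronskian reduces to f' g.\<close>
  have simple: "order x f = 1" if x: "poly f x = 0" for x
  proof -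
    have "poly (pderiv f) x \<noteq> 0" using W[OF neg[OF x]] x by auto
    moreover have "order x f \<noteq> 0" using x f0 by (simp add: order_root)
    ultimately show ?thesis using order_pderiv[OF f0 x] by (auto simp: order_root)
  qed
  define us where "us = zeros f"
  note us = zeros_simple[OF f simple, folded us_def]
  have between: "\<exists>v. us ! Suc i < v \<and> v < us ! i \<and> poly g v = 0" if i: "i < degree g" for i
  proof (rule ccontr)
    assume none: "\<not> ?thesis"
    define a b where "a = us ! Suc i" and "b = us ! i"
    have "a < b" using us(1,3) i deg by (auto simp: a_def b_def sorted_wrt_iff_nth_less)
    have ab: "poly f a = 0" "poly f b = 0"
      using us(1,2) i deg nth_mem[of i us] nth_mem[of "Suc i" us] by (auto simp: a_def b_def)
    have neg': "x < 0" if "x \<le> b" for x using neg[OF ab(2)] that by simp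
    \<comment> \<open>At the endpoints, which are zeros of f, the Wronskian excludes a zero of g;
      inside, \<open>none\<close> does.\<close>
    have gx: "poly g x \<noteq> 0" if "a \<le> x" "x \<le> b" for x
    proof (cases "x = a \<or> x = b")
      case True
      then show ?thesis using W[of x] neg'[of x] ab that by auto
    next
      case False
      then show ?thesis using none that by (auto simp: a_def b_def less_le)
    qed
    have "\<exists>z. a < z \<and> z < b \<and> ((\<lambda>x. poly f x / poly g x) has_real_derivative 0) (at z)"
    proof (rule Rolle[OF \<open>a < b\<close>])
      show "poly f a / poly g a = poly f b / poly g b" using ab by simp
      show "continuous_on {a..b} (\<lambda>x. poly f x / poly g x)"
        using gx by (intro continuous_intros) auto
      show "(\<lambda>x. poly f x / poly g x) differentiable at x" if "a < x" "x < b" for x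
        using gx that by (intro derivative_intros) auto
    qed
    then obtain z where z: "a < z" "z < b"
      and D: "((\<lambda>x. poly f x / poly g x) has_real_derivative 0) (at z)" by blast
    have gz: "poly g z \<noteq> 0" using gx z by simp
    have "((\<lambda>x. poly f x / poly g x) has_real_derivative
       (poly (pderiv f) z * poly g z - poly f z * poly (pderiv g) z) / (poly g z * poly g z)) (at z)"
      using gz by (intro DERIV_divide poly_DERIV)
    from DERIV_unique[OF this D] show False
      using W[of z] neg'[of z] z gz by simp
  qed
  then obtain v where v: "\<And>i. i < degree g \<Longrightarrow> us ! Suc i < v i \<and> v i < us ! i \<and> poly g (v i) = 0"
    by metis
  define vs where "vs = map v [0..<degree g]"
  have v_less: "v j < v i" if "i < j" "j < degree g" for i j
  proof -
    have "v j < us ! j" using v that by auto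
    also have "us ! j \<le> us ! Suc i"
    proof (cases "Suc i = j")
      case False
      then have "us ! j < us ! Suc i"
        using us(1,3) that deg by (auto simp: sorted_wrt_iff_nth_less)
      then show ?thesis by simp
    qed simp
    also have "us ! Suc i < v i" using v that by auto
    finally show ?thesis .
  qed
  then have sorted: "sorted_wrt (>) vs"
    by (auto simp: vs_def sorted_wrt_iff_nth_less)
  then have dist: "distinct vs"
    by (simp add: sorted_wrt_iff_nth_less distinct_conv_nth) (metis less_irrefl nat_neq_iff)
  \<comment> \<open>An inclusion of multisets of equal size is an equality, so the zeros of g are
    simple as well.\<close>
  have "mset vs \<subseteq># proots g"
  proof (rule mset_subset_eqI)
    fix x
    show "count (mset vs) x \<le> count (proots g) x"
    proof (cases "x \<in> set vs")
      case True
      then have "poly g x = 0" using v by (auto simp: vs_def)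
      then have "order x g \<ge> 1" using g0 by (simp add: order_root Suc_le_eq)
      moreover have "count (mset vs) x \<le> 1" using dist True unfolding distinct_count_atmost_1 by simp
      ultimately show ?thesis using g0 by simp
    next
      case False
      then have "count (mset vs) x = 0" by (simp add: count_eq_zero_iff)
      then show ?thesis by linarith
    qed
  qed
  moreover have "size (mset vs) = size (proots g)"
    using size_proots_real_rooted[OF g] by (simp add: vs_def)
  ultimately have mset: "mset vs = proots g"
    by (metis mset_subset_size less_irrefl subset_mset.le_less)
  have "sorted (rev vs)"
    unfolding sorted_wrt_rev by (rule sorted_wrt_mono_rel[OF _ sorted]) auto
  then have "sorted_list_of_multiset (proots g) = rev vs"
    unfolding mset [symmetric] by (metis mset_rev sorted_list_of_multiset_mset sorted_sort_id)
  then have "zeros g = vs" by (simp add: zeros_def)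
  then show ?thesis
    using f g deg v by (simp add: strictly_interlaces_def us_def vs_def)
qed

section \<open>The Baxter polynomials\<close>

text \<open>Apart from j!, the factorials depend only on N - j, so differentiation lowers N by
  exactly one.\<close>

definition appell_poly :: "nat \<Rightarrow> real poly" where
  "appell_poly N = (\<Sum>j\<le>N. monom (1 / (fact j * fact (N - j) * fact (N - j + 1) * fact (N - j + 2))) j)"

lemma coeff_appell_poly:
  "coeff (appell_poly N) j =
     (if j \<le> N then 1 / (fact j * fact (N - j) * fact (N - j + 1) * fact (N - j + 2)) else 0)"
  by (simp add: appell_poly_def coeff_sum)

lemma degree_appell_poly [simp]: "degree (appell_poly N) = N"
  by (intro antisym degree_le le_degree) (auto simp: coeff_appell_poly)

lemma pderiv_appell_poly: "pderiv (appell_poly (Suc N)) = appell_poly N"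
proof -
  have "real (Suc j) * (1 / (fact (Suc j) * x)) = 1 / (fact j * x)" for j x
    by (simp del: of_nat_Suc)
  then show ?thesis
    by (auto simp: poly_eq_iff coeff_pderiv coeff_appell_poly mult.assoc simp del: fact_Suc)
qed

text \<open>Composed of two multiplier sequences: the inner one yields a real-rooted polynomial, and
  the outer one makes its nonzero zeros simple.\<close>

definition fact_mult :: "real poly \<Rightarrow> real poly" where
  "fact_mult p = scale_coeffs (\<lambda>j. 1 / fact (2 + j)) (scale_coeffs (\<lambda>j. 1 / fact (1 + j)) p)"

lemma coeff_fact_mult: "coeff (fact_mult p) j = coeff p j / (fact (1 + j) * fact (2 + j))"
  by (simp add: fact_mult_def)

lemma degree_fact_mult: "degree (fact_mult p) = degree p"
  by (simp add: fact_mult_def degree_scale_coeffs)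

lemma fact_mult_lincomb:
  "fact_mult (smult a p + smult b q) = smult a (fact_mult p) + smult b (fact_mult q)"
  by (simp add: poly_eq_iff coeff_fact_mult add_divide_distrib)

lemma
  assumes "real_rooted p"
  shows real_rooted_fact_mult: "real_rooted (fact_mult p)"
    and order_fact_mult: "x \<noteq> 0 \<Longrightarrow> order x (fact_mult p) \<le> 1"
proof -
  have *: "real_rooted (scale_coeffs (\<lambda>j. 1 / fact (a + j)) q)" if "real_rooted q" for a q
    using multiplier_sequence_inverse_fact that unfolding multiplier_sequence_def by blast
  show "real_rooted (fact_mult p)"
    unfolding fact_mult_def by (intro * assms)
  show "order x (fact_mult p) \<le> 1" if "x \<noteq> 0"
    unfolding fact_mult_def by (intro * assms order_scale_coeffs_inverse_fact that)
qed

lemma real_rooted_smult: "c \<noteq> 0 \<Longrightarrow> real_rooted p \<Longrightarrow> real_rooted (smult c p)"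
  using real_rooted_mult_iff[of "[:c:]" p] by simp

lemma real_rooted_power: "real_rooted p \<Longrightarrow> real_rooted (p ^ n)"
  by (induction n) (simp_all add: real_rooted_mult_iff one_pCons del: one_poly_eq_simps)

lemma coeff_one_plus_X_power: "coeff ([:1, 1:] ^ N) j = (of_nat (N choose j) :: real)"
proof (cases "j \<le> N")
  case False
  then show ?thesis by (simp add: binomial_eq_0 coeff_eq_0 degree_linear_power)
qed (simp add: coeff_linear_poly_power)

text \<open>Reversal replaces j by N - j in the factorials brought in by \<open>fact_mult\<close>,
  and dividing by N! turns the binomial coefficient into 1/(j! (N-j)!).\<close>

lemma real_rooted_appell_poly: "real_rooted (appell_poly N)"
proof -
  define q where "q = fact_mult ([:1, 1:] ^ N)"
  have "real_rooted q"
    unfolding q_def by (intro real_rooted_fact_mult real_rooted_power) (simp add: real_rooted_linear)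
  then have "real_rooted (smult (1 / fact N) (reflect_poly q))"
    by (intro real_rooted_smult real_rooted_reflect_poly) simp_all
  also have "smult (1 / fact N) (reflect_poly q) = appell_poly N"
  proof (rule poly_eqI)
    fix j
    have dq: "degree q = N"
      by (simp add: q_def degree_fact_mult degree_linear_power)
    have cq: "coeff q i = real (N choose i) / (fact (1 + i) * fact (2 + i))" for i
      by (simp only: q_def coeff_fact_mult coeff_one_plus_X_power)
    have "real (N choose (N - j)) = fact N / (fact j * fact (N - j))" if "j \<le> N"
      using that by (simp add: binomial_fact ac_simps)
    then show "coeff (smult (1 / fact N) (reflect_poly q)) j = coeff (appell_poly N) j"
      unfolding coeff_smult coeff_reflect_poly dq cq coeff_appell_poly
      by (simp add: ac_simps del: fact_Suc)
  qed
  finally show ?thesis .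
qed

text \<open>Each of the three binomial coefficients contributes one factor (N+2)!, hence the
  cube.\<close>

lemma PB_Suc_eq:
  "PB (Suc N) = smult (2 / (real (Suc N) * (real (Suc N) + 1) ^ 2) * fact (N + 2) ^ 3)
     (fact_mult (appell_poly N))"
proof (rule poly_eqI)
  fix j
  define c where "c = 2 / (real (Suc N) * (real (Suc N) + 1) ^ 2)"
  have coeff: "coeff (PB (Suc N)) j = (\<Sum>k = 1..Suc N. if k - 1 = j then c *
        real ((N + 2) choose (k - 1)) * real ((N + 2) choose k) * real ((N + 2) choose (k + 1)) else 0)"
  proof -
    have "Suc N + 1 = N + 2" by simp
    then show ?thesis unfolding PB_def coeff_sum coeff_monom c_def by (simp only:)
  qed
  show "coeff (PB (Suc N)) j = coeff (smult (c * fact (N + 2) ^ 3) (fact_mult (appell_poly N))) j"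
  proof (cases "j \<le> N")
    case True
    \<comment> \<open>As k starts at 1, the condition k - 1 = j singles out k = j + 1.\<close>
    have "coeff (PB (Suc N)) j = (\<Sum>k\<in>{Suc j}. c *
        real ((N + 2) choose (k - 1)) * real ((N + 2) choose k) * real ((N + 2) choose (k + 1)))"
      unfolding coeff using True by (intro sum.mono_neutral_cong_right) auto
    also have "\<dots> = c * real ((N + 2) choose j) * real ((N + 2) choose (j + 1)) * real ((N + 2) choose (j + 2))"
      by simp
    also have "real ((N + 2) choose j) = fact (N + 2) / (fact j * fact (N - j + 2))"
      using True binomial_fact[of j "N + 2", where 'a = real] by (simp only: Nat.add_diff_assoc2)
    also have "real ((N + 2) choose (j + 1)) = fact (N + 2) / (fact (j + 1) * fact (N - j + 1))"
    proof -
      have "N + 2 - (j + 1) = N - j + 1" using True by simp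
      then show ?thesis using True binomial_fact[of "j + 1" "N + 2", where 'a = real] by simp
    qed
    also have "real ((N + 2) choose (j + 2)) = fact (N + 2) / (fact (j + 2) * fact (N - j))"
      using True binomial_fact[of "j + 2" "N + 2", where 'a = real] by simp
    finally show ?thesis using True
      by (simp add: coeff_fact_mult coeff_appell_poly power3_eq_cube ac_simps del: fact_Suc)
  next
    case False
    then have "coeff (PB (Suc N)) j = 0" unfolding coeff by (intro sum.neutral) auto
    then show ?thesis using False by (simp add: coeff_fact_mult coeff_appell_poly)
  qed
qed

lemma degree_PB_Suc [simp]: "degree (PB (Suc N)) = N"
  by (simp add: PB_Suc_eq degree_fact_mult)

lemma real_rooted_PB_Suc: "real_rooted (PB (Suc N))"
  by (simp add: PB_Suc_eq real_rooted_smult real_rooted_fact_mult real_rooted_appell_poly)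

text \<open>The coefficients are nonnegative and the constant one is positive.\<close>

lemma PB_Suc_root_neg:
  assumes "poly (PB (Suc N)) x = 0"
  shows "x < 0"
proof (rule ccontr)
  assume x: "\<not> x < 0"
  have coeff: "coeff (PB (Suc N)) j \<ge> 0" for j
    by (simp add: PB_Suc_eq coeff_fact_mult coeff_appell_poly del: fact_Suc)
  have "0 < coeff (PB (Suc N)) 0"
    by (simp add: PB_Suc_eq coeff_fact_mult coeff_appell_poly add_pos_nonneg)
  also have "\<dots> = coeff (PB (Suc N)) 0 * x ^ 0" by simp
  also have "\<dots> \<le> poly (PB (Suc N)) x"
    unfolding poly_altdef using x coeff by (intro member_le_sum mult_nonneg_nonneg) auto
  finally show False using assms by simp
qed

section \<open>Linear combinations of consecutive Baxter polynomials and their Wronskian\<close>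

text \<open>Such a combination is \<open>fact_mult\<close> applied to a combination of
  \<open>appell_poly (Suc N)\<close> and its derivative, which is real-rooted.\<close>

lemma order_lincomb_PB:
  assumes "a \<noteq> 0 \<or> b \<noteq> 0" "x \<noteq> 0"
  shows "smult a (PB (Suc (Suc N))) + smult b (PB (Suc N)) \<noteq> 0"
    and "order x (smult a (PB (Suc (Suc N))) + smult b (PB (Suc N))) \<le> 1"
proof -
  define c where "c N = 2 / (real (Suc N) * (real (Suc N) + 1) ^ 2) * fact (N + 2) ^ 3" for N
  have c: "c N \<noteq> 0" for N by (simp add: c_def add_nonneg_eq_0_iff)
  define h where "h = smult (a * c (Suc N)) (appell_poly (Suc N))
     + smult (b * c N) (pderiv (appell_poly (Suc N)))"
  have "smult a (PB (Suc (Suc N))) + smult b (PB (Suc N)) = fact_mult h"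
    by (simp only: h_def PB_Suc_eq fact_mult_lincomb pderiv_appell_poly smult_smult c_def)
  moreover have "real_rooted h"
    unfolding h_def by (rule real_rooted_lincomb_pderiv) (use assms c real_rooted_appell_poly in auto)
  ultimately show "smult a (PB (Suc (Suc N))) + smult b (PB (Suc N)) \<noteq> 0"
    and "order x (smult a (PB (Suc (Suc N))) + smult b (PB (Suc N))) \<le> 1"
    using real_rooted_fact_mult order_fact_mult assms by (auto simp: real_rooted_def)
qed

text \<open>A zero of the Wronskian at x would give a nontrivial combination of the two polynomials
  with a double zero at x.\<close>

lemma wronskian_PB:
  assumes "x \<noteq> 0"
  shows "poly (pderiv (PB (Suc (Suc N))) * PB (Suc N) - PB (Suc (Suc N)) * pderiv (PB (Suc N))) x \<noteq> 0"
proof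
  define f g where "f = PB (Suc (Suc N))" and "g = PB (Suc N)"
  assume "poly (pderiv (PB (Suc (Suc N))) * PB (Suc N) - PB (Suc (Suc N)) * pderiv (PB (Suc N))) x = 0"
  then have W: "poly (pderiv f) x * poly g x = poly f x * poly (pderiv g) x"
    by (simp add: f_def g_def)
  have no_double: "poly (pderiv (smult a f + smult b g)) x \<noteq> 0"
    if "a \<noteq> 0 \<or> b \<noteq> 0" "poly (smult a f + smult b g) x = 0" for a b
  proof -
    define h where "h = smult a f + smult b g"
    have h: "h \<noteq> 0" "order x h \<le> 1" "poly h x = 0"
      using order_lincomb_PB[OF that(1) assms, of N] that(2) by (simp_all add: h_def f_def g_def)
    then have "order x (pderiv h) = 0" using order_pderiv[of h x] by simp
    moreover have "pderiv h \<noteq> 0"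
      using h by (metis degree_eq_zeroE pderiv_eq_0_iff pCons_0_0 poly_const_conv)
    ultimately show ?thesis by (simp add: order_root h_def)
  qed
  show False
  proof (cases "poly f x = 0 \<and> poly g x = 0")
    \<comment> \<open>At a common zero every combination vanishes, so the coefficients are chosen to
      cancel the derivative; f'(x) \<noteq> 0 makes them nontrivial.\<close>
    case True
    then have "poly (pderiv f) x \<noteq> 0" using no_double[of 1 0] by simp
    then show False
      using True no_double[of "poly (pderiv g) x" "- poly (pderiv f) x"]
      by (simp add: pderiv_add pderiv_smult pderiv_diff pderiv_minus)
  next
    \<comment> \<open>The combination g(x) f - f(x) g vanishes at x, and its derivative there is the
      Wronskian.\<close>
    case False
    then show False
      using W no_double[of "poly g x" "- poly f x"]
      by (auto simp: pderiv_add pderiv_smult pderiv_diff pderiv_minus mult.commute)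
  qed
qed

theorem theorem1p1: "sturm_sequence {1..} PB"
proof -
  \<comment> \<open>Degrees grow by one at each step, so the interlacing alternative of
    \<open>\<prec>\<close> always applies.\<close>
  have "strictly_interlaces (PB (Suc N)) (PB (Suc (Suc N)))" for N
    using real_rooted_PB_Suc PB_Suc_root_neg wronskian_PB
    by (intro strictly_interlacesI) auto
  then have "real_rooted (PB n)" "PB n \<prec> PB (Suc n)" if "n \<ge> 1" for n
    using that real_rooted_PB_Suc by (cases n; simp add: sturm_prec_def)+
  then show ?thesis by (simp add: sturm_sequence_def)
qed

end
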